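(* Let $s\ge1$ be an integer and $\sigma>0$. Let $z(x)=\frac{1}{\sqrt2\,\sigma}e^{-|x|\sqrt2/\sigma}$ be the Laplace density and define $$\bar\tau_{s,z}(x)=\begin{cases}\frac{\sqrt2}{\sigma}\, e^{-|x|\sqrt2/(6\sigma)} & \text{if } |x|\ge 9\sqrt2\,\sigma s,\\[2pt] \frac{\sqrt2}{\sigma}\cdot\frac{e^2 s}{1+|x|\sqrt2/\sigma} & \text{if } |x|\le 9\sqrt2\,\sigma s.\end{cases}$$ Then $\tau_{s,z}(x)\le\bar\tau_{s,z}(x)$ for all $x\in\mathbb{R}$, and $\int_{-\infty}^{\infty}\bar\tau_{s,z}(x)\,dx=O(s\ln s)$.
   Context: For a probability density $p$ on $\mathbb{R}$ and $f:\mathbb{R}\to\mathbb{C}$, write $\|f\|_p^2=\int_{\mathbb{R}}|f(y)|^2p(y)\,dy$. Let $\mathcal{T}_s=\{f(x)=\sum_{j=1}^s a_je^{i\lambda_jx}: a_j\in\mathbb{C},\ \lambda_j\in\mathbb{R}\}$. The Fourier sparse leverage score is $\tau_{s,p}(x)=\sup_{f\in\mathcal{T}_s,\ \|f\|_p\neq 0}\frac{|f(x)|^2p(x)}{\|f\|_p^2}$. *)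

theory Defs
  imports "HOL-Analysis.Analysis" "HOL-Library.Landau_Symbols"
begin

definition weighted_norm :: "(real \<Rightarrow> real) \<Rightarrow> (real \<Rightarrow> complex) \<Rightarrow> real" where
  "weighted_norm p f = sqrt (\<integral>y. (cmod (f y))\<^sup>2 * p y \<partial>lborel)"

text \<open>The frequencies are not required to be distinct.\<close>

definition fourier_sparse :: "nat \<Rightarrow> (real \<Rightarrow> complex) set" where
  "fourier_sparse s =
     {f. \<exists>(a :: nat \<Rightarrow> complex) (\<omega> :: nat \<Rightarrow> real).
           f = (\<lambda>x. \<Sum>j=1..s. a j * exp (\<i> * complex_of_real (\<omega> j * x)))}"

text \<open>The supremum is taken in the extended reals, so that an upper bound on it is never an
  artefact of the supremum of an unbounded set of reals being unspecified.\<close>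

definition leverage_score :: "nat \<Rightarrow> (real \<Rightarrow> real) \<Rightarrow> real \<Rightarrow> ereal" where
  "leverage_score s p x =
     (SUP f \<in> {f \<in> fourier_sparse s. weighted_norm p f \<noteq> 0}.
        ereal ((cmod (f x))\<^sup>2 * p x / (weighted_norm p f)\<^sup>2))"

definition laplace_density :: "real \<Rightarrow> real \<Rightarrow> real" where
  "laplace_density \<sigma> x = 1 / (sqrt 2 * \<sigma>) * exp (- \<bar>x\<bar> * sqrt 2 / \<sigma>)"

text \<open>The two cases of the bound are usually written with overlapping conditions
  \<open>\<bar>x\<bar> \<ge> 9 \<surd>2 \<sigma> s\<close> and \<open>\<bar>x\<bar> \<le> 9 \<surd>2 \<sigma> s\<close>, although the values at
  \<open>\<bar>x\<bar> = 9 \<surd>2 \<sigma> s\<close> differ (\<open>exp (- 3 s)\<close> against \<open>exp 2 * s / (1 + 18 s)\<close>, up to the common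
  factor). The smaller value, that of the first case, is used there, so that an upper bound by
  \<open>laplace_bound\<close> entails the bounds of both cases.\<close>

definition laplace_bound :: "nat \<Rightarrow> real \<Rightarrow> real \<Rightarrow> real" where
  "laplace_bound s \<sigma> x =
     (if \<bar>x\<bar> \<ge> 9 * sqrt 2 * \<sigma> * real s
      then sqrt 2 / \<sigma> * exp (- \<bar>x\<bar> * sqrt 2 / (6 * \<sigma>))
      else sqrt 2 / \<sigma> * (exp 2 * real s / (1 + \<bar>x\<bar> * sqrt 2 / \<sigma>)))"

end

theory Submission
  imports Defs
begin

text \<open>
  After rescaling, the weight is \<open>exp (- \<bar>u\<bar>)\<close> and the point is \<open>t \<ge> 0\<close>.

  The reproducing kernel of an \<open>s\<close>-dimensional space of functions on an interval of length
  \<open>T\<close> integrates to at most \<open>s\<close> along the diagonal, hence is at most \<open>s / T\<close> at some point.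
  Spans of exponentials with complex exponents are translation invariant, so
  \<open>\<bar>f t\<bar>\<^sup>2 \<le> s / T * \<integral> \<bar>f\<bar>\<^sup>2\<close> over \<open>[t - T, t + T]\<close> for every exponential sum \<open>f\<close> with \<open>s\<close>
  terms. For \<open>t < 1\<close> this is applied to the Fourier sum \<open>g\<close> with \<open>T = 1\<close>, and for
  \<open>1 \<le> t < 18 s\<close> to \<open>h u = g u * exp (- u / 2)\<close> with \<open>T = t\<close>.

  For \<open>t \<ge> 18 s\<close>, the exponentials in \<open>h\<close> are split off one at a time by Blaschke factors. Each
  step splits \<open>\<integral> \<bar>h\<bar>\<^sup>2\<close> over \<open>[0, \<infinity>)\<close> orthogonally and costs at most a factor \<open>5\<close> in the integral with
  the growing weight \<open>exp (u / 3)\<close>, so \<open>\<integral> exp (u / 3) \<bar>h\<bar>\<^sup>2 \<le> 5 ^ s * \<integral> \<bar>h\<bar>\<^sup>2\<close> over \<open>[0, \<infinity>)\<close>. The local bound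
  with \<open>T = 3\<close> turns this into pointwise decay.
\<close>

subsection \<open>Point evaluation on finite-dimensional spaces\<close>

definition interval_inner :: "real \<Rightarrow> real \<Rightarrow> (real \<Rightarrow> complex) \<Rightarrow> (real \<Rightarrow> complex) \<Rightarrow> complex" where
  "interval_inner a b f g = integral {a..b} (\<lambda>x. f x * cnj (g x))"

lemma interval_inner_sum_left:
  assumes "finite A" "\<And>k. k \<in> A \<Longrightarrow> continuous_on {a..b} (f k)" "continuous_on {a..b} g"
  shows "interval_inner a b (\<lambda>x. \<Sum>k\<in>A. c k * f k x) g = (\<Sum>k\<in>A. c k * interval_inner a b (f k) g)"
proof -
  have "interval_inner a b (\<lambda>x. \<Sum>k\<in>A. c k * f k x) g
      = integral {a..b} (\<lambda>x. \<Sum>k\<in>A. c k * (f k x * cnj (g x)))"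
    unfolding interval_inner_def by (simp add: sum_distrib_right mult.assoc)
  also have "\<dots> = (\<Sum>k\<in>A. integral {a..b} (\<lambda>x. c k * (f k x * cnj (g x))))"
    by (intro integral_sum integrable_continuous_interval continuous_intros assms)
  finally show ?thesis by (simp add: interval_inner_def)
qed

lemma interval_inner_diff_left:
  assumes "continuous_on {a..b} f" "continuous_on {a..b} f'" "continuous_on {a..b} g"
  shows "interval_inner a b (\<lambda>x. f x - f' x) g = interval_inner a b f g - interval_inner a b f' g"
  unfolding interval_inner_def left_diff_distrib
  by (intro integral_diff integrable_continuous_interval continuous_intros assms)

lemma interval_inner_cong:
  assumes "\<And>x. x \<in> {a..b} \<Longrightarrow> f x = f' x" "\<And>x. x \<in> {a..b} \<Longrightarrow> g x = g' x"
  shows "interval_inner a b f g = interval_inner a b f' g'"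
  unfolding interval_inner_def by (intro integral_cong) (simp add: assms)

lemma interval_inner_cnj:
  "interval_inner a b g f = cnj (interval_inner a b f g)"
proof -
  have "cnj (integral {a..b} (\<lambda>x. f x * cnj (g x))) = integral {a..b} (\<lambda>x. cnj (f x * cnj (g x)))"
    by (rule Henstock_Kurzweil_Integration.integral_cnj)
  then show ?thesis by (simp add: interval_inner_def mult.commute)
qed

lemma interval_inner_scale_right:
  "interval_inner a b f (\<lambda>x. c * g x) = cnj c * interval_inner a b f g"
  by (simp add: interval_inner_def mult.left_commute)

lemma interval_inner_self:
  assumes "continuous_on {a..b} f"
  shows "interval_inner a b f f = of_real (integral {a..b} (\<lambda>x. (cmod (f x))\<^sup>2))"
proof -
  have "(\<lambda>x. (cmod (f x))\<^sup>2) integrable_on {a..b}"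
    by (intro integrable_continuous_interval continuous_intros assms)
  then have "((\<lambda>x. of_real ((cmod (f x))\<^sup>2) :: complex) has_integral
      of_real (integral {a..b} (\<lambda>x. (cmod (f x))\<^sup>2))) {a..b}"
    by (intro has_integral_of_real integrable_integral)
  then show ?thesis
    unfolding interval_inner_def complex_norm_square by (rule integral_unique)
qed

text \<open>Continuity upgrades a vanishing integral of a square to vanishing at every point. In
  Gram--Schmidt this disposes of the residual of a dependent vector.\<close>

lemma interval_inner_self_eq_0:
  assumes "continuous_on {a..b} f" "a < b" "interval_inner a b f f = 0" "x \<in> {a..b}"
  shows "f x = 0"
proof -
  have "integral {a..b} (\<lambda>x. (cmod (f x))\<^sup>2) = 0"
    using assms(3) by (simp add: interval_inner_self[OF assms(1)])
  then have "\<forall>x\<in>{a..b}. (cmod (f x))\<^sup>2 = 0"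
    using assms(1,2)
    by (subst (asm) integral_eq_0_iff) (auto intro!: continuous_intros)
  with assms(4) show ?thesis by auto
qed

text \<open>Gram--Schmidt, where a vector that depends on the previous ones contributes a zero function.\<close>

lemma Gram_Schmidt_interval:
  assumes "finite A" "a < b" "\<forall>j\<in>A. continuous_on {a..b} (v j)"
  shows "\<exists>\<phi>. (\<forall>k\<in>A. continuous_on {a..b} (\<phi> k) \<and>
             (interval_inner a b (\<phi> k) (\<phi> k) = 1 \<or> (\<forall>x. \<phi> k x = 0))) \<and>
           (\<forall>i\<in>A. \<forall>j\<in>A. i \<noteq> j \<longrightarrow> interval_inner a b (\<phi> i) (\<phi> j) = 0) \<and>
           (\<forall>j\<in>A. \<forall>x\<in>{a..b}. v j x = (\<Sum>k\<in>A. interval_inner a b (v j) (\<phi> k) * \<phi> k x))"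
  using assms(1,3)
proof (induction A rule: finite_induct)
  case empty
  then show ?case by simp
next
  case (insert n A)
  let ?ip = "interval_inner a b"
  have "\<forall>j\<in>A. continuous_on {a..b} (v j)" using insert.prems by blast
  from insert.IH[OF this] obtain \<phi> where
      \<phi>: "\<forall>k\<in>A. continuous_on {a..b} (\<phi> k) \<and> (?ip (\<phi> k) (\<phi> k) = 1 \<or> (\<forall>x. \<phi> k x = 0))"
        "\<forall>i\<in>A. \<forall>j\<in>A. i \<noteq> j \<longrightarrow> ?ip (\<phi> i) (\<phi> j) = 0"
        "\<forall>j\<in>A. \<forall>x\<in>{a..b}. v j x = (\<Sum>k\<in>A. ?ip (v j) (\<phi> k) * \<phi> k x)"
    by (elim exE conjE)
  note cont = conjunct1[OF bspec[OF \<phi>(1)]] and unit = conjunct2[OF bspec[OF \<phi>(1)]]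
    and orth = \<phi>(2)[rule_format] and expand = \<phi>(3)[rule_format]
  have contv: "continuous_on {a..b} (v n)" using insert.prems by simp
  \<comment> \<open>\<open>p\<close> is the projection of the new vector onto the earlier ones,
    \<open>r\<close> the residual.\<close>
  define p where "p x = (\<Sum>k\<in>A. ?ip (v n) (\<phi> k) * \<phi> k x)" for x
  define r where "r x = v n x - p x" for x
  have contp: "continuous_on {a..b} p"
    unfolding p_def by (intro continuous_intros cont)
  have contr: "continuous_on {a..b} r"
    unfolding r_def by (intro continuous_intros contv contp)
  have r_orth: "?ip r (\<phi> k) = 0" if k: "k \<in> A" for k
  proof -
    have "?ip p (\<phi> k) = (\<Sum>i\<in>A. ?ip (v n) (\<phi> i) * ?ip (\<phi> i) (\<phi> k))"
      unfolding p_def using insert.hyps cont k by (intro interval_inner_sum_left) auto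
    also have "\<dots> = (\<Sum>i\<in>A. if i = k then ?ip (v n) (\<phi> k) * ?ip (\<phi> k) (\<phi> k) else 0)"
      by (intro sum.cong) (auto simp: orth k)
    also have "\<dots> = ?ip (v n) (\<phi> k) * ?ip (\<phi> k) (\<phi> k)"
      using insert.hyps k by simp
    also have "\<dots> = ?ip (v n) (\<phi> k)"
      using unit[OF k] by (auto simp: interval_inner_def)
    finally show ?thesis
      unfolding r_def using contv contp cont[OF k] by (subst interval_inner_diff_left) auto
  qed
  then have r_orth': "?ip (\<phi> k) r = 0" if "k \<in> A" for k
    using that by (simp add: interval_inner_cnj[of a b "\<phi> k" r])
  define N where "N = sqrt (integral {a..b} (\<lambda>x. (cmod (r x))\<^sup>2))"
  have N: "?ip r r = of_real (N\<^sup>2)"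
    unfolding N_def by (subst real_sqrt_pow2)
      (auto simp: interval_inner_self[OF contr] intro!: integral_nonneg integrable_continuous_interval continuous_intros contr)
  \<comment> \<open>Because \<open>inverse 0 = 0\<close>, a residual of norm 0 makes
    \<open>\<psi>\<close> vanish on the whole line, although \<open>r\<close> itself is only known
    to vanish on the interval.\<close>
  define \<psi> where "\<psi> x = of_real (inverse N) * r x" for x
  have cont\<psi>: "continuous_on {a..b} \<psi>"
    unfolding \<psi>_def by (intro continuous_intros contr)
  have ip\<psi>: "?ip f \<psi> = of_real (inverse N) * ?ip f r" for f
    unfolding \<psi>_def by (simp add: interval_inner_scale_right)
  have ip\<psi>': "?ip \<psi> f = of_real (inverse N) * ?ip r f" for f
    by (simp add: interval_inner_cnj[of a b _ f] ip\<psi>)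
  have unit\<psi>: "?ip \<psi> \<psi> = 1 \<or> (\<forall>x. \<psi> x = 0)"
  proof (cases "N = 0")
    case True
    then show ?thesis by (simp add: \<psi>_def)
  next
    case False
    then have "?ip \<psi> \<psi> = 1" by (simp add: ip\<psi> ip\<psi>' N power2_eq_square field_simps)
    then show ?thesis ..
  qed
  have span_orth: "?ip (\<lambda>x. \<Sum>k\<in>A. c k * \<phi> k x) r = 0" for c
    using insert.hyps cont contr by (subst interval_inner_sum_left) (auto simp: r_orth')
  have old: "?ip (v j) \<psi> = 0" if j: "j \<in> A" for j
  proof -
    have "?ip (v j) r = ?ip (\<lambda>x. \<Sum>k\<in>A. ?ip (v j) (\<phi> k) * \<phi> k x) r"
      by (intro interval_inner_cong expand j refl)
    then show ?thesis by (simp add: ip\<psi> span_orth)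
  qed
  \<comment> \<open>Since \<open>p\<close> is orthogonal to \<open>r\<close>, pairing
    \<open>v n\<close> with \<open>r\<close> gives \<open>N\<^sup>2\<close>. The component of
    \<open>v n\<close> along \<open>\<psi>\<close> is therefore exactly \<open>r\<close>.\<close>
  have "?ip r r = ?ip (v n) r - ?ip p r"
    unfolding r_def[abs_def]
    using contv contp contr by (intro interval_inner_diff_left) (auto simp: r_def[abs_def])
  moreover have "?ip p r = 0" unfolding p_def[abs_def] by (rule span_orth)
  ultimately have ipvr: "?ip (v n) r = of_real (N\<^sup>2)" using N by simp
  have new: "v n x = p x + ?ip (v n) \<psi> * \<psi> x" if x: "x \<in> {a..b}" for x
  proof (cases "N = 0")
    case True
    then have "r x = 0" using N by (intro interval_inner_self_eq_0[OF contr \<open>a < b\<close> _ x]) simp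
    then show ?thesis using True by (simp add: r_def \<psi>_def)
  next
    case False
    then have "?ip (v n) \<psi> * \<psi> x = r x"
      by (simp add: ip\<psi> ipvr \<psi>_def power2_eq_square)
    then show ?thesis by (simp add: r_def)
  qed
  define \<phi>' where "\<phi>' = \<phi>(n := \<psi>)"
  have [simp]: "\<phi>' n = \<psi>" "\<And>k. k \<in> A \<Longrightarrow> \<phi>' k = \<phi> k"
    using insert.hyps by (auto simp: \<phi>'_def)
  have sum': "(\<Sum>k\<in>insert n A. F (\<phi>' k)) = F \<psi> + (\<Sum>k\<in>A. F (\<phi> k))" for F :: "_ \<Rightarrow> complex"
    using insert.hyps by simp
  show ?case
  proof (intro exI[of _ \<phi>'] conjI ballI impI)
    fix k assume "k \<in> insert n A"
    then show "continuous_on {a..b} (\<phi>' k)" "?ip (\<phi>' k) (\<phi>' k) = 1 \<or> (\<forall>x. \<phi>' k x = 0)"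
      using cont cont\<psi> unit\<psi> by (force dest: unit)+
  next
    fix i j assume "i \<in> insert n A" "j \<in> insert n A" "i \<noteq> j"
    then show "?ip (\<phi>' i) (\<phi>' j) = 0"
      using orth by (auto simp: ip\<psi> ip\<psi>' r_orth r_orth')
  next
    fix j x assume j: "j \<in> insert n A" and x: "x \<in> {a..b}"
    show "v j x = (\<Sum>k\<in>insert n A. ?ip (v j) (\<phi>' k) * \<phi>' k x)"
    proof (cases "j = n")
      case True
      then show ?thesis using new[OF x] unfolding sum'[of "\<lambda>f. ?ip (v j) f * f x"] by (simp add: p_def)
    next
      case False
      then have "j \<in> A" using j by simp
      then show ?thesis using expand[OF _ x] old unfolding sum'[of "\<lambda>f. ?ip (v j) f * f x"] by simp
    qed
  qed
qed

text \<open>The reproducing kernel of an \<open>n\<close>-dimensional space has trace at most \<open>n\<close>, so on an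
  interval its diagonal is somewhere at most \<open>n\<close> divided by the length.\<close>

lemma span_point_evaluation_bound:
  fixes v :: "'i \<Rightarrow> real \<Rightarrow> complex"
  assumes "finite A" "a < b" "\<And>j. j \<in> A \<Longrightarrow> continuous_on {a..b} (v j)"
  shows "\<exists>y\<in>{a..b}. \<forall>c. (cmod (\<Sum>j\<in>A. c j * v j y))\<^sup>2
           \<le> real (card A) / (b - a) * integral {a..b} (\<lambda>x. (cmod (\<Sum>j\<in>A. c j * v j x))\<^sup>2)"
proof -
  let ?ip = "interval_inner a b"
  have "\<forall>j\<in>A. continuous_on {a..b} (v j)" using assms(3) by blast
  from Gram_Schmidt_interval[OF assms(1,2) this] obtain \<phi> where
      \<phi>: "\<forall>k\<in>A. continuous_on {a..b} (\<phi> k) \<and> (?ip (\<phi> k) (\<phi> k) = 1 \<or> (\<forall>x. \<phi> k x = 0))"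
        "\<forall>i\<in>A. \<forall>j\<in>A. i \<noteq> j \<longrightarrow> ?ip (\<phi> i) (\<phi> j) = 0"
        "\<forall>j\<in>A. \<forall>x\<in>{a..b}. v j x = (\<Sum>k\<in>A. ?ip (v j) (\<phi> k) * \<phi> k x)"
    by (elim exE conjE)
  note cont = conjunct1[OF bspec[OF \<phi>(1)]] and unit = conjunct2[OF bspec[OF \<phi>(1)]]
    and expand = \<phi>(3)[rule_format]
  \<comment> \<open>The diagonal of the reproducing kernel of the span.\<close>
  define K where "K x = (\<Sum>k\<in>A. (cmod (\<phi> k x))\<^sup>2)" for x
  have contK: "continuous_on {a..b} K"
    unfolding K_def by (intro continuous_intros cont)
  \<comment> \<open>A minimiser of \<open>K\<close> does not depend on the coefficients
    \<open>c\<close>, so one point serves the whole span. The minimum is at most the mean.\<close>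
  then obtain y where y: "y \<in> {a..b}" and ymin: "\<And>x. x \<in> {a..b} \<Longrightarrow> K y \<le> K x"
    using continuous_attains_inf[OF _ _ contK] \<open>a < b\<close> by auto
  \<comment> \<open>Only an inequality, since a dependent vector contributes a zero
    function.\<close>
  have "integral {a..b} (\<lambda>x. (cmod (\<phi> k x))\<^sup>2) \<le> 1" if "k \<in> A" for k
    using unit[OF that] interval_inner_self[OF cont[OF that]] by auto
  then have "integral {a..b} K \<le> real (card A)"
    unfolding K_def using sum_bounded_above[of A _ "1::real"]
    by (subst integral_sum) (auto intro!: integrable_continuous_interval continuous_intros cont assms(1))
  moreover have "integral {a..b} (\<lambda>x. K y) \<le> integral {a..b} K"
    by (intro integral_le integrable_continuous_interval continuous_intros contK ymin)
  ultimately have Ky: "K y \<le> real (card A) / (b - a)"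
    using \<open>a < b\<close> by (simp add: field_simps)
  show ?thesis
  proof (intro bexI[OF _ y] allI)
    fix c
    define f where "f x = (\<Sum>j\<in>A. c j * v j x)" for x
    have contf: "continuous_on {a..b} f"
      unfolding f_def by (intro continuous_intros assms)
    have ipf: "?ip f (\<phi> k) = (\<Sum>j\<in>A. c j * ?ip (v j) (\<phi> k))" if "k \<in> A" for k
      unfolding f_def by (intro interval_inner_sum_left assms cont that)
    have f: "f x = (\<Sum>k\<in>A. ?ip f (\<phi> k) * \<phi> k x)" if "x \<in> {a..b}" for x
    proof -
      have "f x = (\<Sum>j\<in>A. \<Sum>k\<in>A. c j * (?ip (v j) (\<phi> k) * \<phi> k x))"
        unfolding f_def using expand[OF _ that] by (intro sum.cong) (auto simp flip: sum_distrib_left)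
      also have "\<dots> = (\<Sum>k\<in>A. \<Sum>j\<in>A. c j * (?ip (v j) (\<phi> k) * \<phi> k x))"
        by (rule sum.swap)
      finally show ?thesis by (simp add: ipf sum_distrib_right mult.assoc)
    qed
    have "?ip f f = ?ip (\<lambda>x. \<Sum>k\<in>A. ?ip f (\<phi> k) * \<phi> k x) f"
      by (intro interval_inner_cong f refl)
    also have "\<dots> = (\<Sum>k\<in>A. ?ip f (\<phi> k) * ?ip (\<phi> k) f)"
      by (intro interval_inner_sum_left assms cont contf)
    also have "\<dots> = of_real (\<Sum>k\<in>A. (cmod (?ip f (\<phi> k)))\<^sup>2)"
      unfolding of_real_sum complex_norm_square by (simp add: interval_inner_cnj[of a b _ f])
    finally have Parseval: "integral {a..b} (\<lambda>x. (cmod (f x))\<^sup>2) = (\<Sum>k\<in>A. (cmod (?ip f (\<phi> k)))\<^sup>2)"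
      unfolding interval_inner_self[OF contf] of_real_eq_iff .
    have "cmod (f y) \<le> (\<Sum>k\<in>A. cmod (?ip f (\<phi> k)) * cmod (\<phi> k y))"
      unfolding f[OF y] by (rule order.trans[OF norm_sum]) (simp add: norm_mult)
    then have "(cmod (f y))\<^sup>2 \<le> (\<Sum>k\<in>A. cmod (?ip f (\<phi> k)) * cmod (\<phi> k y))\<^sup>2"
      by (simp add: power_mono)
    also have "\<dots> \<le> (\<Sum>k\<in>A. (cmod (?ip f (\<phi> k)))\<^sup>2) * K y"
      unfolding K_def by (rule Cauchy_Schwarz_ineq_sum)
    also have "\<dots> \<le> (\<Sum>k\<in>A. (cmod (?ip f (\<phi> k)))\<^sup>2) * (real (card A) / (b - a))"
      by (intro mult_left_mono Ky sum_nonneg) simp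
    finally show "(cmod (f y))\<^sup>2 \<le> real (card A) / (b - a) * integral {a..b} (\<lambda>x. (cmod (f x))\<^sup>2)"
      by (simp add: Parseval mult.commute)
  qed
qed

subsection \<open>Exponential sums\<close>

text \<open>Complex exponents cover both Fourier sums and their damped versions. A general index set
  allows exponentials to be removed one at a time.\<close>

definition exp_sum :: "'i set \<Rightarrow> ('i \<Rightarrow> complex) \<Rightarrow> ('i \<Rightarrow> complex) \<Rightarrow> real \<Rightarrow> complex" where
  "exp_sum A c \<nu> x = (\<Sum>j\<in>A. c j * exp (\<nu> j * of_real x))"

lemma continuous_on_exp_sum [continuous_intros]:
  "continuous_on S f \<Longrightarrow> continuous_on S (\<lambda>x. exp_sum A c \<nu> (f x))"
  unfolding exp_sum_def by (intro continuous_intros)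

lemma exp_sum_shift:
  "exp_sum A c \<nu> (x + y) = exp_sum A (\<lambda>j. c j * exp (\<nu> j * of_real y)) \<nu> x"
  by (simp add: exp_sum_def distrib_left exp_add mult_ac)

lemma exp_sum_has_vector_derivative:
  "(exp_sum A c \<nu> has_vector_derivative exp_sum A (\<lambda>j. c j * \<nu> j) \<nu> x) (at x within S)"
proof -
  have "((\<lambda>z. \<Sum>j\<in>A. c j * exp (\<nu> j * z)) has_field_derivative
      (\<Sum>j\<in>A. c j * \<nu> j * exp (\<nu> j * of_real x))) (at (of_real x))"
    by (auto intro!: derivative_eq_intros sum.cong simp: mult_ac)
  from has_vector_derivative_real_field[OF this, of S] show ?thesis
    by (simp add: exp_sum_def[abs_def] o_def)
qed

text \<open>The span of the exponentials is translation invariant, so the good point of an interval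
  may be moved to any prescribed point.\<close>

lemma exp_sum_pointwise_bound:
  assumes "finite A" "T > 0"
  shows "(cmod (exp_sum A c \<nu> t))\<^sup>2
    \<le> real (card A) / T * integral {t - T..t + T} (\<lambda>x. (cmod (exp_sum A c \<nu> x))\<^sup>2)"
proof -
  let ?f = "exp_sum A c \<nu>"
  have "\<exists>y\<in>{0..T}. \<forall>c. (cmod (exp_sum A c \<nu> y))\<^sup>2
      \<le> real (card A) / (T - 0) * integral {0..T} (\<lambda>x. (cmod (exp_sum A c \<nu> x))\<^sup>2)"
    unfolding exp_sum_def
    by (intro span_point_evaluation_bound assms continuous_intros)
  then obtain y where y: "y \<in> {0..T}" and bound: "\<And>c. (cmod (exp_sum A c \<nu> y))\<^sup>2
           \<le> real (card A) / T * integral {0..T} (\<lambda>x. (cmod (exp_sum A c \<nu> x))\<^sup>2)"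
    by auto
  \<comment> \<open>The shift changes the coefficients in a way that depends on \<open>y\<close>;
    this is harmless because \<open>bound\<close> holds for all coefficients at the same
    \<open>y\<close>.\<close>
  have "(cmod (?f (y + (t - y))))\<^sup>2
      \<le> real (card A) / T * integral {0..T} (\<lambda>x. (cmod (?f (x + (t - y))))\<^sup>2)"
    unfolding exp_sum_shift by (rule bound)
  also have "integral {0..T} (\<lambda>x. (cmod (?f (x + (t - y))))\<^sup>2)
      = integral {t - y..T + (t - y)} (\<lambda>x. (cmod (?f x))\<^sup>2)"
    using integral_shift_Icc_real[of 0 T "\<lambda>x. (cmod (?f x))\<^sup>2" "t - y"] by (simp add: o_def add.commute)
  \<comment> \<open>The position of \<open>y\<close> in \<open>{0..T}\<close> is unknown; the
    doubled window contains every possible shift.\<close>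
  also have "\<dots> \<le> integral {t - T..t + T} (\<lambda>x. (cmod (?f x))\<^sup>2)"
    using y by (intro integral_subset_le integrable_continuous_interval continuous_intros) auto
  finally show ?thesis
    using assms by (simp add: divide_right_mono mult_left_mono)
qed

text \<open>Removes the boundary term at infinity in \<open>peel_energy\<close>.\<close>

lemma exp_sum_tendsto_0:
  assumes "\<And>j. j \<in> A \<Longrightarrow> Re (\<nu> j) < 0"
  shows "(exp_sum A c \<nu> \<longlongrightarrow> 0) at_top"
proof -
  have "((\<lambda>x. c j * exp (\<nu> j * of_real x)) \<longlongrightarrow> 0) at_top" if "j \<in> A" for j
  proof (rule tendsto_mult_right_zero, rule tendsto_norm_zero_cancel)
    have "filterlim (\<lambda>x. Re (\<nu> j) * x) at_bot at_top"
      using assms[OF that] by (intro filterlim_tendsto_neg_mult_at_bot[OF tendsto_const _ filterlim_ident])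
    then have "((\<lambda>x. exp (Re (\<nu> j) * x)) \<longlongrightarrow> 0) at_top"
      by (rule filterlim_compose[OF exp_at_bot])
    then show "((\<lambda>x. norm (exp (\<nu> j * of_real x))) \<longlongrightarrow> 0) at_top"
      by simp
  qed
  then have "((\<lambda>x. \<Sum>j\<in>A. c j * exp (\<nu> j * of_real x)) \<longlongrightarrow> (\<Sum>j\<in>A. 0)) at_top"
    by (rule tendsto_sum)
  then show ?thesis by (simp add: exp_sum_def[abs_def])
qed

section \<open>Splitting off exponentials by Blaschke factors\<close>

text \<open>In the Laplace domain, splitting off one exponential with a Blaschke factor reads
  \<open>H = C / (p - \<nu> k) + (p + cnj (\<nu> k)) / (p - \<nu> k) * H\<^sub>1\<close>, where \<open>H\<^sub>1\<close> involves the other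
  exponentials only. Back in the time domain this is the differential equation
  \<open>h' - \<nu> k h = h\<^sub>1' + cnj (\<nu> k) h\<^sub>1\<close>, from which the coefficients of \<open>h\<^sub>1\<close> are read off. For
  \<open>Re (\<nu> k) = - 1/2\<close> it makes \<open>\<bar>h - h\<^sub>1\<bar>\<^sup>2\<close> a primitive of \<open>\<bar>h\<^sub>1\<bar>\<^sup>2 - \<bar>h\<bar>\<^sup>2\<close>.\<close>

definition peel :: "('i \<Rightarrow> complex) \<Rightarrow> 'i \<Rightarrow> ('i \<Rightarrow> complex) \<Rightarrow> 'i \<Rightarrow> complex" where
  "peel \<nu> k c j = c j * (\<nu> j - \<nu> k) / (\<nu> j + cnj (\<nu> k))"

lemma peel_has_derivative:
  fixes \<nu> c :: "'i \<Rightarrow> complex"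
  assumes "finite A" "k \<notin> A" "\<And>j. j \<in> insert k A \<Longrightarrow> Re (\<nu> j) = - 1/2"
  defines "h \<equiv> exp_sum (insert k A) c \<nu>" and "h1 \<equiv> exp_sum A (peel \<nu> k c) \<nu>"
  shows "((\<lambda>x. (cmod (h x - h1 x))\<^sup>2) has_real_derivative (cmod (h1 x))\<^sup>2 - (cmod (h x))\<^sup>2) (at x within S)"
proof -
  let ?h' = "exp_sum (insert k A) (\<lambda>j. c j * \<nu> j) \<nu> x"
  let ?h1' = "exp_sum A (\<lambda>j. peel \<nu> k c j * \<nu> j) \<nu> x"
  \<comment> \<open>The factor \<open>\<nu> j - \<nu> k\<close> kills the term \<open>j = k\<close>,
    which leaves a sum over \<open>A\<close>.\<close>
  have "?h' - \<nu> k * h x = (\<Sum>j\<in>insert k A. c j * (\<nu> j - \<nu> k) * exp (\<nu> j * of_real x))"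
    by (simp add: h_def exp_sum_def sum_distrib_left algebra_simps sum_subtractf del: sum.insert)
  also have "\<dots> = (\<Sum>j\<in>A. c j * (\<nu> j - \<nu> k) * exp (\<nu> j * of_real x))"
    using assms(1,2) by simp
  also have "\<dots> = (\<Sum>j\<in>A. peel \<nu> k c j * (\<nu> j + cnj (\<nu> k)) * exp (\<nu> j * of_real x))"
  proof (intro sum.cong refl)
    fix j assume "j \<in> A"
    then have "Re (\<nu> j + cnj (\<nu> k)) \<noteq> 0" using assms(3)[of j] assms(3)[of k] by simp
    then have "\<nu> j + cnj (\<nu> k) \<noteq> 0" by (metis zero_complex.sel(1))
    then show "c j * (\<nu> j - \<nu> k) * exp (\<nu> j * of_real x)
        = peel \<nu> k c j * (\<nu> j + cnj (\<nu> k)) * exp (\<nu> j * of_real x)"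
      by (simp add: peel_def)
  qed
  also have "\<dots> = ?h1' + cnj (\<nu> k) * h1 x"
    by (simp add: h1_def exp_sum_def sum_distrib_left algebra_simps sum.distrib)
  finally have deriv_eq: "?h' - ?h1' = \<nu> k * h x + cnj (\<nu> k) * h1 x"
    by (simp add: algebra_simps)
  have "((\<lambda>x. h x - h1 x) has_vector_derivative ?h' - ?h1') (at x within S)"
    unfolding h_def h1_def by (intro has_vector_derivative_diff exp_sum_has_vector_derivative)
  from bounded_bilinear.has_vector_derivative[OF bounded_bilinear_inner this this]
  have "((\<lambda>x. (h x - h1 x) \<bullet> (h x - h1 x)) has_vector_derivative
      2 * ((h x - h1 x) \<bullet> (\<nu> k * h x + cnj (\<nu> k) * h1 x))) (at x within S)"
    by (simp add: deriv_eq inner_commute)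
  \<comment> \<open>The two cross terms are complex conjugates with opposite signs, so their real
    parts cancel.\<close>
  moreover have "2 * ((h x - h1 x) \<bullet> (\<nu> k * h x + cnj (\<nu> k) * h1 x)) = 2 * Re (\<nu> k) * ((cmod (h x))\<^sup>2 - (cmod (h1 x))\<^sup>2)"
    unfolding cmod_power2 inner_complex_def by (simp add: algebra_simps power2_eq_square)
  moreover have "2 * Re (\<nu> k) = -1" using assms(3)[of k] by simp
  ultimately show ?thesis
    by (simp add: has_real_derivative_iff_has_vector_derivative power2_norm_eq_inner)
qed

text \<open>The orthogonal splitting of energy: integrating the primitive of
  \<open>peel_has_derivative\<close> over the half line leaves only its value at 0, since
  \<open>h\<close> and \<open>h1\<close> decay. A bound uniform in \<open>T\<close> stands in for
  the improper integral.\<close>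

lemma peel_energy:
  fixes \<nu> c :: "'i \<Rightarrow> complex"
  assumes "finite A" "k \<notin> A" "\<And>j. j \<in> insert k A \<Longrightarrow> Re (\<nu> j) = - 1/2"
  defines "h \<equiv> exp_sum (insert k A) c \<nu>" and "h1 \<equiv> exp_sum A (peel \<nu> k c) \<nu>"
  assumes E: "\<And>T. T \<ge> 0 \<Longrightarrow> integral {0..T} (\<lambda>x. (cmod (h x))\<^sup>2) \<le> E" and "T \<ge> 0"
  shows "integral {0..T} (\<lambda>x. (cmod (h1 x))\<^sup>2) \<le> E - (cmod (h 0 - h1 0))\<^sup>2"
proof -
  let ?d = "\<lambda>x. (cmod (h x - h1 x))\<^sup>2"
  have [continuous_intros]: "continuous_on S h" "continuous_on S h1" for S
    unfolding h_def h1_def by (intro continuous_intros continuous_on_exp_sum[where f="\<lambda>x. x", simplified])+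
  \<comment> \<open>\<open>T'\<close> is a second horizon that tends to infinity while
    \<open>T\<close> stays fixed.\<close>
  have "integral {0..T} (\<lambda>x. (cmod (h1 x))\<^sup>2) - E + ?d 0 \<le> ?d T'" if "T' \<ge> T" for T'
  proof -
    have "((\<lambda>x. (cmod (h1 x))\<^sup>2 - (cmod (h x))\<^sup>2) has_integral ?d T' - ?d 0) {0..T'}"
      using peel_has_derivative[OF assms(1-3), where c = c] that \<open>T \<ge> 0\<close> unfolding h_def h1_def
      by (intro fundamental_theorem_of_calculus) (auto simp flip: has_real_derivative_iff_has_vector_derivative)
    then have "integral {0..T'} (\<lambda>x. (cmod (h1 x))\<^sup>2 - (cmod (h x))\<^sup>2) = ?d T' - ?d 0"
      by (rule integral_unique)
    moreover have "integral {0..T'} (\<lambda>x. (cmod (h1 x))\<^sup>2 - (cmod (h x))\<^sup>2)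
        = integral {0..T'} (\<lambda>x. (cmod (h1 x))\<^sup>2) - integral {0..T'} (\<lambda>x. (cmod (h x))\<^sup>2)"
      by (intro integral_diff integrable_continuous_interval continuous_intros)
    moreover have "integral {0..T} (\<lambda>x. (cmod (h1 x))\<^sup>2) \<le> integral {0..T'} (\<lambda>x. (cmod (h1 x))\<^sup>2)"
      using that by (intro integral_subset_le integrable_continuous_interval continuous_intros) auto
    moreover have "integral {0..T'} (\<lambda>x. (cmod (h x))\<^sup>2) \<le> E"
      using that \<open>T \<ge> 0\<close> by (intro E) simp
    ultimately show ?thesis by simp
  qed
  then have "eventually (\<lambda>T'. integral {0..T} (\<lambda>x. (cmod (h1 x))\<^sup>2) - E + ?d 0 \<le> ?d T') at_top"
    by (auto simp: eventually_at_top_linorder)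
  moreover have "(?d \<longlongrightarrow> (cmod (0 - 0))\<^sup>2) at_top"
    unfolding h_def h1_def
    by (intro tendsto_intros exp_sum_tendsto_0) (use assms(3) in force)+
  ultimately have "integral {0..T} (\<lambda>x. (cmod (h1 x))\<^sup>2) - E + ?d 0 \<le> (cmod (0 - 0))\<^sup>2"
    by (intro tendsto_lowerbound) auto
  then show ?thesis by simp
qed

text \<open>Induction on the number of exponentials, with \<open>c\<close> and \<open>E\<close>
  varying because peeling changes the coefficients and lowers the energy. The step integrates the
  derivative of \<open>exp (x / 3)\<close> times the squared modulus of
  \<open>h - h1\<close>.\<close>

lemma exp_sum_weighted_energy:
  fixes \<nu> :: "'i \<Rightarrow> complex"
  assumes "finite A" "\<And>j. j \<in> A \<Longrightarrow> Re (\<nu> j) = - 1/2"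
    and "\<And>T. T \<ge> 0 \<Longrightarrow> integral {0..T} (\<lambda>x. (cmod (exp_sum A c \<nu> x))\<^sup>2) \<le> E"
    and "T \<ge> 0"
  shows "integral {0..T} (\<lambda>x. exp (x / 3) * (cmod (exp_sum A c \<nu> x))\<^sup>2) \<le> 5 ^ card A * E"
  using assms
proof (induction A arbitrary: c E rule: finite_induct)
  case empty
  from empty(2)[of 0] show ?case by (simp add: exp_sum_def)
next
  case (insert k A)
  define h where "h = exp_sum (insert k A) c \<nu>"
  define h1 where "h1 = exp_sum A (peel \<nu> k c) \<nu>"
  define \<delta> where "\<delta> = (cmod (h 0 - h1 0))\<^sup>2"
  define W where "W f = integral {0..T} (\<lambda>x. exp (x / 3) * (cmod (f x))\<^sup>2)" for f :: "real \<Rightarrow> complex"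
  let ?d = "\<lambda>x. h x - h1 x"
  have cont [continuous_intros]: "continuous_on S h" "continuous_on S h1" for S
    unfolding h_def h1_def by (intro continuous_intros continuous_on_exp_sum[where f="\<lambda>x. x", simplified])+
  have int: "(\<lambda>x. exp (x / 3) * (cmod (f x))\<^sup>2) integrable_on {0..T}"
    if "continuous_on {0..T} f" for f :: "real \<Rightarrow> complex"
    by (intro integrable_continuous_interval continuous_intros that) simp
  have "W h1 \<le> 5 ^ card A * (E - \<delta>)"
    unfolding W_def h1_def
  proof (rule insert.IH)
    show "Re (\<nu> j) = - 1/2" if "j \<in> A" for j using insert.prems(1) that by simp
    show "T \<ge> 0" by fact
    show "integral {0..T} (\<lambda>x. (cmod (exp_sum A (peel \<nu> k c) \<nu> x))\<^sup>2) \<le> E - \<delta>" if "T \<ge> 0" for T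
      unfolding \<delta>_def h_def h1_def
      by (rule peel_energy[OF insert.hyps(1,2) insert.prems(1,2) that])
  qed
  have "((\<lambda>x. exp (x / 3) * (cmod (?d x))\<^sup>2) has_real_derivative
      exp (x / 3) * (cmod (h1 x))\<^sup>2 - exp (x / 3) * (cmod (h x))\<^sup>2
      + 1/3 * (exp (x / 3) * (cmod (?d x))\<^sup>2)) (at x within S)" for x S
  proof -
    have d: "((\<lambda>x. (cmod (?d x))\<^sup>2) has_real_derivative (cmod (h1 x))\<^sup>2 - (cmod (h x))\<^sup>2) (at x within S)"
      unfolding h_def h1_def by (rule peel_has_derivative[OF insert.hyps(1,2) insert.prems(1)])
    have e: "((\<lambda>x. exp (x / 3)) has_real_derivative exp (x / 3) * (1/3)) (at x within S)"
      by (auto intro!: derivative_eq_intros)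
    show ?thesis
      by (rule DERIV_cong[OF DERIV_mult[OF e d]]) (simp add: algebra_simps)
  qed
  then have "((\<lambda>x. exp (x / 3) * (cmod (h1 x))\<^sup>2 - exp (x / 3) * (cmod (h x))\<^sup>2
      + 1/3 * (exp (x / 3) * (cmod (?d x))\<^sup>2)) has_integral
      exp (T / 3) * (cmod (?d T))\<^sup>2 - exp (0 / 3) * (cmod (?d 0))\<^sup>2) {0..T}"
    using \<open>T \<ge> 0\<close> unfolding has_real_derivative_iff_has_vector_derivative
    by (intro fundamental_theorem_of_calculus)
  moreover have "((\<lambda>x. exp (x / 3) * (cmod (h1 x))\<^sup>2 - exp (x / 3) * (cmod (h x))\<^sup>2
      + 1/3 * (exp (x / 3) * (cmod (?d x))\<^sup>2)) has_integral W h1 - W h + 1/3 * W ?d) {0..T}"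
    unfolding W_def
    by (intro has_integral_add has_integral_diff has_integral_mult_right integrable_integral
        int continuous_intros)
  ultimately have "exp (T / 3) * (cmod (?d T))\<^sup>2 - exp (0 / 3) * (cmod (?d 0))\<^sup>2 = W h1 - W h + 1/3 * W ?d"
    by (rule has_integral_unique)
  then have "W h1 - W h + 1/3 * W ?d = exp (T / 3) * (cmod (?d T))\<^sup>2 - \<delta>"
    by (simp add: \<delta>_def)
  moreover have "W ?d \<le> 2 * W h + 2 * W h1"
  proof -
    have "W ?d \<le> integral {0..T} (\<lambda>x. 2 * (exp (x / 3) * (cmod (h x))\<^sup>2) + 2 * (exp (x / 3) * (cmod (h1 x))\<^sup>2))"
      unfolding W_def
    proof (intro integral_le integrable_add integrable_on_mult_right int continuous_intros)
      fix x
      have "(cmod (?d x))\<^sup>2 \<le> (cmod (h x) + cmod (h1 x))\<^sup>2"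
        by (intro power_mono norm_triangle_ineq4) simp
      also have "\<dots> \<le> 2 * (cmod (h x))\<^sup>2 + 2 * (cmod (h1 x))\<^sup>2"
        using sum_squares_bound[of "cmod (h x)" "cmod (h1 x)"] by (simp add: power2_sum)
      finally have "exp (x / 3) * (cmod (?d x))\<^sup>2 \<le> exp (x / 3) * (2 * (cmod (h x))\<^sup>2 + 2 * (cmod (h1 x))\<^sup>2)"
        by simp
      then show "exp (x / 3) * (cmod (?d x))\<^sup>2 \<le> 2 * (exp (x / 3) * (cmod (h x))\<^sup>2) + 2 * (exp (x / 3) * (cmod (h1 x))\<^sup>2)"
        by (simp add: algebra_simps)
    qed
    also have "\<dots> = 2 * W h + 2 * W h1"
      unfolding W_def
      by (intro integral_unique has_integral_add has_integral_mult_right integrable_integral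
          int continuous_intros)
    finally show ?thesis .
  qed
  \<comment> \<open>The term \<open>1/3 * W ?d\<close> is at most
    \<open>2/3 * W h + 2/3 * W h1\<close>. Absorbing \<open>2/3 * W h\<close> on the left leaves
    \<open>1/3 * W h\<close>, and multiplying by 3 gives the constants 5 and 3. Absorption works
    because the rate \<open>1/3\<close> is below \<open>1/2\<close>.\<close>
  ultimately have "W h \<le> 5 * W h1 + 3 * \<delta>"
    using mult_nonneg_nonneg[OF exp_ge_zero zero_le_power2, of "T / 3" "cmod (?d T)"] by argo
  also have "\<dots> \<le> 5 * (5 ^ card A * (E - \<delta>)) + 3 * \<delta>"
    using \<open>W h1 \<le> _\<close> by simp
  \<comment> \<open>The energy \<open>\<delta>\<close> that \<open>h1\<close> lacks pays for the
    extra \<open>3 * \<delta>\<close>, so no additive error accumulates.\<close>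
  also have "\<dots> \<le> 5 * 5 ^ card A * E"
  proof -
    have "3 * \<delta> \<le> 5 * 5 ^ card A * \<delta>"
      by (intro mult_right_mono order.trans[OF _ mult_left_mono[OF one_le_power]]) (auto simp: \<delta>_def)
    then show ?thesis by (simp add: algebra_simps)
  qed
  finally show ?case
    using insert.hyps by (simp add: W_def h_def)
qed

subsection \<open>The Laplace weight\<close>

text \<open>Turns half-line integrals into majorants for functions of the absolute value.\<close>

lemma has_bochner_integral_add_reflection:
  fixes F :: "real \<Rightarrow> real"
  assumes "has_bochner_integral lborel F I"
  shows "has_bochner_integral lborel (\<lambda>x. F x + F (- x)) (2 * I)"
proof -
  have "has_bochner_integral lborel (\<lambda>x. F (- x)) I"
    using assms lborel_has_bochner_integral_real_affine_iff[of "-1" F I 0] by simp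
  from has_bochner_integral_add[OF assms this] show ?thesis by (simp only: mult_2)
qed

lemma has_bochner_integral_exp_half_line:
  assumes "a > 0"
  shows "has_bochner_integral lborel (\<lambda>x::real. exp (- a * x) * indicator {0..} x) (1 / a)"
proof (rule has_bochner_integral_nn_integral)
  have "(\<integral>\<^sup>+ x. ennreal (exp (- a * x)) * indicator {0..} x \<partial>lborel) = ennreal (0 - (- exp (- a * 0) / a))"
  proof (rule nn_integral_FTC_atLeast)
    show "((\<lambda>x. - exp (- a * x) / a) has_real_derivative exp (- a * x)) (at x)" for x
      using assms by (auto intro!: derivative_eq_intros)
    have "filterlim (\<lambda>x. - a * x) at_bot at_top"
      using assms by (intro filterlim_tendsto_neg_mult_at_bot[OF tendsto_const _ filterlim_ident]) simp
    then have "((\<lambda>x. exp (- a * x)) \<longlongrightarrow> 0) at_top"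
      by (rule filterlim_compose[OF exp_at_bot])
    from tendsto_divide[OF tendsto_minus[OF this] tendsto_const[of a]]
    show "((\<lambda>x. - exp (- a * x) / a) \<longlongrightarrow> 0) at_top" using assms by simp
  qed auto
  then show "(\<integral>\<^sup>+ x. ennreal (exp (- a * x) * indicator {0..} x) \<partial>lborel) = ennreal (1 / a)"
    by (simp add: ennreal_mult' ennreal_indicator flip: ennreal_indicator)
qed (use assms in auto)

lemma integrable_exp_abs:
  assumes "a > 0"
  shows "integrable lborel (\<lambda>x::real. exp (- a * \<bar>x\<bar>))"
  \<comment> \<open>Both halves contribute at 0, so the reflected sum dominates there without being
    equal.\<close>
  using has_bochner_integral_add_reflection[OF has_bochner_integral_exp_half_line[OF assms]]
  by (intro Bochner_Integration.integrable_bound[OF integrable.intros])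
     (auto simp: indicator_def)

text \<open>\<open>laplace_bound\<close> in the variable \<open>sqrt 2 / \<sigma> * x\<close>,
  without its prefactor. That prefactor is the Jacobian, so the integral does not depend on
  \<sigma>.\<close>

definition rescaled_bound :: "nat \<Rightarrow> real \<Rightarrow> real" where
  "rescaled_bound s t = (if \<bar>t\<bar> \<ge> 18 * real s then exp (- \<bar>t\<bar> / 6) else exp 2 * real s / (1 + \<bar>t\<bar>))"

lemma laplace_bound_eq_rescaled_bound:
  assumes "\<sigma> > 0"
  shows "laplace_bound s \<sigma> x = sqrt 2 / \<sigma> * rescaled_bound s (sqrt 2 / \<sigma> * x)"
proof -
  have *: "\<bar>sqrt 2 / \<sigma> * x\<bar> = \<bar>x\<bar> * sqrt 2 / \<sigma>"
    using assms by (simp add: abs_mult)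
  have "9 * sqrt 2 * \<sigma> * real s \<le> \<bar>x\<bar> \<longleftrightarrow> sqrt 2 / \<sigma> * (9 * sqrt 2 * \<sigma> * real s) \<le> sqrt 2 / \<sigma> * \<bar>x\<bar>"
    using assms by (subst mult_le_cancel_left_pos) auto
  also have "sqrt 2 / \<sigma> * (9 * sqrt 2 * \<sigma> * real s) = 18 * real s"
    using assms by simp
  finally show ?thesis
    unfolding laplace_bound_def rescaled_bound_def * by (simp add: mult_ac)
qed

lemma rescaled_bound_integral:
  shows "integrable lborel (rescaled_bound s)"
    and "integral\<^sup>L lborel (rescaled_bound s) \<le> 2 * (exp 2 * real s * ln (1 + 18 * real s) + 6)"
    and "0 \<le> integral\<^sup>L lborel (rescaled_bound s)"
proof -
  \<comment> \<open>A half-line majorant that adds both branches. The first integrates to the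
    logarithm, the second, taken over the whole half line, to 6.\<close>
  define F where "F x = exp 2 * real s / (1 + x) * indicator {0..18 * real s} x
    + exp (- (1/6) * x) * indicator {0..} x" for x
  have "has_bochner_integral lborel (\<lambda>x. exp 2 * real s / (1 + x) * indicator {0..18 * real s} x)
      (exp 2 * real s * ln (1 + 18 * real s) - exp 2 * real s * ln (1 + 0))"
    by (rule has_bochner_integral_FTC_Icc_nonneg) (auto intro!: derivative_eq_intros)
  from has_bochner_integral_add[OF this has_bochner_integral_exp_half_line[of "1/6"]]
  have F: "has_bochner_integral lborel F (exp 2 * real s * ln (1 + 18 * real s) + 6)"
    by (simp add: F_def[abs_def])
  note F2 = has_bochner_integral_add_reflection[OF F]
  have nonneg: "0 \<le> rescaled_bound s x" for x by (simp add: rescaled_bound_def)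
  have le: "rescaled_bound s x \<le> F x + F (- x)" for x
    by (auto simp: rescaled_bound_def F_def indicator_def abs_if)
  have [measurable]: "rescaled_bound s \<in> borel_measurable borel"
    unfolding rescaled_bound_def[abs_def] by measurable
  show int: "integrable lborel (rescaled_bound s)"
  proof (rule Bochner_Integration.integrable_bound[OF integrable.intros[OF F2]])
    show "AE x in lborel. norm (rescaled_bound s x) \<le> norm (F x + F (- x))"
      using le nonneg by (intro AE_I2) (smt (verit) real_norm_def)
  qed simp
  have "integral\<^sup>L lborel (rescaled_bound s) \<le> (\<integral>x. F x + F (- x) \<partial>lborel)"
    by (intro integral_mono int le integrable.intros[OF F2])
  then show "integral\<^sup>L lborel (rescaled_bound s) \<le> 2 * (exp 2 * real s * ln (1 + 18 * real s) + 6)"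
    using has_bochner_integral_integral_eq[OF F2] by simp
  show "0 \<le> integral\<^sup>L lborel (rescaled_bound s)"
    by (intro integral_nonneg_AE AE_I2 nonneg)
qed

section \<open>The pointwise bound for the weight \<open>exp (- \<bar>u\<bar>)\<close>\<close>

lemma exp_sum_add_const:
  "exp_sum A c (\<lambda>j. \<nu> j + z) x = exp (z * of_real x) * exp_sum A c \<nu> x"
  unfolding exp_sum_def sum_distrib_left distrib_right exp_add by (simp add: mult_ac)

lemma integrable_exp_sum_laplace:
  fixes \<theta> :: "'i \<Rightarrow> real" and c :: "'i \<Rightarrow> complex"
  shows "integrable lborel (\<lambda>u. (cmod (exp_sum A c (\<lambda>j. \<i> * of_real (\<theta> j)) u))\<^sup>2 * exp (- \<bar>u\<bar>))"
proof (rule Bochner_Integration.integrable_bound)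
  show "integrable lborel (\<lambda>u. (\<Sum>j\<in>A. cmod (c j))\<^sup>2 * exp (- 1 * \<bar>u\<bar>))"
    by (intro integrable_mult_right integrable_exp_abs) simp
  have "cmod (exp_sum A c (\<lambda>j. \<i> * of_real (\<theta> j)) u) \<le> (\<Sum>j\<in>A. cmod (c j))" for u
    unfolding exp_sum_def by (rule order.trans[OF norm_sum]) (simp add: norm_mult)
  then show "AE u in lborel. norm ((cmod (exp_sum A c (\<lambda>j. \<i> * of_real (\<theta> j)) u))\<^sup>2 * exp (- \<bar>u\<bar>))
      \<le> norm ((\<Sum>j\<in>A. cmod (c j))\<^sup>2 * exp (- 1 * \<bar>u\<bar>))"
    by (intro AE_I2) (auto simp: abs_mult intro!: power_mono)
  show "(\<lambda>u. (cmod (exp_sum A c (\<lambda>j. \<i> * of_real (\<theta> j)) u))\<^sup>2 * exp (- \<bar>u\<bar>)) \<in> borel_measurable lborel"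
    unfolding exp_sum_def by measurable
qed

lemma exp_sum_laplace_pointwise:
  fixes \<theta> :: "'i \<Rightarrow> real" and c :: "'i \<Rightarrow> complex"
  assumes "finite A" "card A \<ge> 1" "t \<ge> 0"
  defines "g \<equiv> exp_sum A c (\<lambda>j. \<i> * of_real (\<theta> j))"
  shows "(cmod (g t))\<^sup>2 * exp (- t)
    \<le> rescaled_bound (card A) t * (\<integral>u. (cmod (g u))\<^sup>2 * exp (- \<bar>u\<bar>) \<partial>lborel)"
proof -
  define s where "s = card A"
  have s: "real s \<ge> 1" using assms(2) by (simp add: s_def)
  define G where "G u = (cmod (g u))\<^sup>2 * exp (- \<bar>u\<bar>)" for u
  define E where "E = integral\<^sup>L lborel G"
  \<comment> \<open>Damping by \<open>exp (- u / 2)\<close> absorbs the weight on the positive half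
    line and gives the real part \<open>- 1/2\<close> needed for peeling.\<close>
  define \<nu> where "\<nu> j = \<i> * of_real (\<theta> j) + of_real (- 1/2)" for j
  define h where "h = exp_sum A c \<nu>"
  have intG: "integrable lborel G"
    unfolding G_def g_def by (rule integrable_exp_sum_laplace)
  have cont [continuous_intros]: "continuous_on S g" "continuous_on S h" for S
    unfolding g_def h_def by (intro continuous_on_exp_sum[where f="\<lambda>x. x", simplified] continuous_intros)+
  have contG: "continuous_on S G" for S
    unfolding G_def by (intro continuous_intros)
  have GE: "integral {p..q} G \<le> E" for p q
  proof -
    have "integral {p..q} G \<le> integral UNIV G"
      by (intro integral_subset_le integrable_continuous_interval contG integrable_on_lborel intG)
         (auto simp: G_def)
    then show ?thesis by (simp add: E_def integral_lborel[OF intG])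
  qed
  have E: "E \<ge> 0" using GE[of 1 0] by simp
  have h: "(cmod (h u))\<^sup>2 = (cmod (g u))\<^sup>2 * exp (- u)" for u
    unfolding h_def \<nu>_def g_def exp_sum_add_const
    by (simp add: norm_mult power_mult_distrib exp_double[symmetric] mult.commute flip: exp_of_nat_mult)
  have hE: "integral {p..q} (\<lambda>u. (cmod (h u))\<^sup>2) \<le> E" if "p \<ge> 0" for p q
  proof -
    have "integral {p..q} (\<lambda>u. (cmod (h u))\<^sup>2) = integral {p..q} G"
      using that by (intro integral_cong) (simp add: h G_def)
    then show ?thesis using GE by simp
  qed
  have "(cmod (g t))\<^sup>2 * exp (- t) \<le> rescaled_bound s t * E"
  proof (cases "t \<ge> 18 * real s")
    case True
    then have t: "t \<ge> 18" using s by simp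
    define I where "I = integral {t - 3..t + 3} (\<lambda>u. exp (u / 3) * (cmod (h u))\<^sup>2)"
    have int: "(\<lambda>u. exp (u / 3) * (cmod (h u))\<^sup>2) integrable_on {p..q}" for p q
      by (intro integrable_continuous_interval continuous_intros) simp_all
    \<comment> \<open>Half-width 3 minimises \<open>exp (T / 3) / T\<close>, the cost of localising
      to a window of half-width \<open>T\<close>.\<close>
    have "(cmod (h t))\<^sup>2 \<le> real s / 3 * integral {t - 3..t + 3} (\<lambda>u. (cmod (h u))\<^sup>2)"
      unfolding h_def s_def by (rule exp_sum_pointwise_bound) (use assms in auto)
    also have "integral {t - 3..t + 3} (\<lambda>u. (cmod (h u))\<^sup>2)
        \<le> integral {t - 3..t + 3} (\<lambda>u. exp (1 - t / 3) * (exp (u / 3) * (cmod (h u))\<^sup>2))"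
    proof (intro integral_le integrable_on_mult_right int)
      show "(\<lambda>u. (cmod (h u))\<^sup>2) integrable_on {t - 3..t + 3}"
        by (intro integrable_continuous_interval continuous_intros)
      fix u assume "u \<in> {t - 3..t + 3}"
      then have "1 \<le> exp ((1 - t / 3) + u / 3)" by simp
      then have "1 * (cmod (h u))\<^sup>2 \<le> exp ((1 - t / 3) + u / 3) * (cmod (h u))\<^sup>2"
        by (intro mult_right_mono) auto
      then show "(cmod (h u))\<^sup>2 \<le> exp (1 - t / 3) * (exp (u / 3) * (cmod (h u))\<^sup>2)"
        by (simp only: exp_add mult_1 mult.assoc)
    qed
    also have "\<dots> = exp (1 - t / 3) * I" by (simp add: I_def)
    also have "I \<le> integral {0..t + 3} (\<lambda>u. exp (u / 3) * (cmod (h u))\<^sup>2)"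
      unfolding I_def using t by (intro integral_subset_le int) auto
    also have "\<dots> \<le> 5 ^ s * E"
      unfolding h_def s_def
      by (rule exp_sum_weighted_energy) (use assms hE t in \<open>auto simp: h_def \<nu>_def\<close>)
    finally have "(cmod (h t))\<^sup>2 \<le> real s / 3 * (exp (1 - t / 3) * (5 ^ s * E))"
      by (simp add: mult_left_mono divide_right_mono)
    also have "\<dots> = (real s * (exp 1 / 3) * 5 ^ s) * exp (- t / 3) * E"
      unfolding exp_diff by (simp add: exp_minus field_simps)
    \<comment> \<open>Half of the decay is spent on the factor depending on \<open>s\<close>: that
      factor is at most \<open>15 ^ s\<close>, hence at most \<open>exp (3 * real s)\<close>. This
      matches the threshold \<open>18 * real s\<close>.\<close>
    also have "\<dots> \<le> exp (t / 6) * exp (- t / 3) * E"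
    proof (intro mult_right_mono E)
      have "real s * (exp 1 / 3) * 5 ^ s \<le> real s * 1 * 5 ^ s"
        using exp_le by (intro mult_right_mono mult_left_mono) auto
      also have "\<dots> \<le> 3 ^ s * 5 ^ s"
      proof -
        have "real s < 2 ^ s" by (rule of_nat_less_two_power)
        also have "(2::real) ^ s \<le> 3 ^ s" by (intro power_mono) auto
        finally show ?thesis by simp
      qed
      also have "\<dots> = 15 ^ s" by (simp flip: power_mult_distrib)
      also have "(15::real) ^ s \<le> exp 3 ^ s"
      proof (intro power_mono)
        have "(5/2::real) ^ 3 \<le> exp 1 ^ 3"
          using exp_lower_Taylor_quadratic[of "1::real"] by (intro power_mono) auto
        moreover have "exp (1::real) ^ 3 = exp 3" using exp_of_nat_mult[of 3 "1::real"] by simp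
        ultimately show "(15::real) \<le> exp 3" by (simp add: power3_eq_cube)
      qed simp
      also have "\<dots> = exp (3 * real s)" by (simp add: mult.commute flip: exp_of_nat_mult)
      also have "\<dots> \<le> exp (t / 6)" using True by simp
      finally show "real s * (exp 1 / 3) * 5 ^ s \<le> exp (t / 6)" by simp
    qed auto
    also have "exp (t / 6) * exp (- t / 3) = exp (- t / 6)"
      by (simp flip: exp_add)
    finally show ?thesis using True \<open>t \<ge> 0\<close> by (simp add: rescaled_bound_def h)
  next
    case False
    have e2: "(2::real) \<le> exp 1" using exp_ge_add_one_self[of 1] by simp
    have ee: "exp 2 = exp 1 * (exp 1 :: real)" by (simp flip: exp_add)
    have "(cmod (g t))\<^sup>2 * exp (- t) \<le> exp 2 * real s / (1 + t) * E"
    proof (cases "t < 1")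
      case True
      \<comment> \<open>The window may cross 0, where damping no longer matches the weight, so the
        undamped sum is used. The weight is at least \<open>exp (- (t + 1))\<close> there.\<close>
      have "(cmod (g t))\<^sup>2 \<le> real s / 1 * integral {t - 1..t + 1} (\<lambda>u. (cmod (g u))\<^sup>2)"
        unfolding g_def s_def by (rule exp_sum_pointwise_bound) (use assms in auto)
      also have "integral {t - 1..t + 1} (\<lambda>u. (cmod (g u))\<^sup>2) \<le> integral {t - 1..t + 1} (\<lambda>u. exp (t + 1) * G u)"
      proof (intro integral_le integrable_continuous_interval continuous_intros contG)
        fix u assume "u \<in> {t - 1..t + 1}"
        then have "1 \<le> exp (t + 1 - \<bar>u\<bar>)" using \<open>t \<ge> 0\<close> by auto
        then have "1 * (cmod (g u))\<^sup>2 \<le> exp (t + 1 - \<bar>u\<bar>) * (cmod (g u))\<^sup>2"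
          by (intro mult_right_mono) auto
        then show "(cmod (g u))\<^sup>2 \<le> exp (t + 1) * G u"
          by (simp add: G_def exp_diff exp_minus field_simps)
      qed
      also have "\<dots> \<le> exp (t + 1) * E" using GE by simp
      finally have "(cmod (g t))\<^sup>2 * exp (- t) \<le> real s * (exp (t + 1) * E) * exp (- t)"
        by (simp add: mult_left_mono)
      also have "\<dots> = exp 1 * real s * E" by (simp add: exp_add exp_minus field_simps)
      also have "\<dots> \<le> exp 2 * real s / (1 + t) * E"
      proof (intro mult_right_mono E)
        have "exp 1 * (1 + t) \<le> exp 2" unfolding ee using True e2 by (intro mult_left_mono) auto
        then have "exp 1 * (1 + t) * real s \<le> exp 2 * real s" by (rule mult_right_mono) simp
        then show "exp 1 * real s \<le> exp 2 * real s / (1 + t)"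
          using \<open>t \<ge> 0\<close> by (simp add: field_simps)
      qed
      finally show ?thesis .
    next
      case t1: False
      \<comment> \<open>\<open>T = t\<close> gives the largest centred window inside the positive
        half line.\<close>
      have "(cmod (h t))\<^sup>2 \<le> real s / t * integral {t - t..t + t} (\<lambda>u. (cmod (h u))\<^sup>2)"
        unfolding h_def s_def by (rule exp_sum_pointwise_bound) (use assms t1 in auto)
      also have "\<dots> \<le> real s / t * E"
        using t1 hE[of 0] by (intro mult_left_mono) auto
      also have "\<dots> \<le> exp 2 * real s / (1 + t) * E"
      proof (intro mult_right_mono E)
        have "1 + t \<le> t * 2" using t1 by simp
        also have "\<dots> \<le> t * exp 2"
          using t1 exp_ge_add_one_self[of "2::real"] by (intro mult_left_mono) auto
        finally have "1 + t \<le> t * exp 2" .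
        then have "(1 + t) * real s \<le> t * exp 2 * real s" by (intro mult_right_mono) auto
        then show "real s / t \<le> exp 2 * real s / (1 + t)"
          using t1 by (simp add: field_simps)
      qed
      finally show ?thesis by (simp add: h)
    qed
    then show ?thesis using False \<open>t \<ge> 0\<close> by (simp add: rescaled_bound_def)
  qed
  then show ?thesis by (simp add: s_def E_def G_def[abs_def])
qed

text \<open>The substitution \<open>y = k * u\<close> normalises the weight and only rescales the
  frequencies. The sign of \<open>k\<close> reflects a negative \<open>x\<close> to a point
  \<open>t \<ge> 0\<close>.\<close>

lemma fourier_sparse_laplace_ratio:
  assumes "s \<ge> 1" "\<sigma> > 0" and f: "f \<in> fourier_sparse s" and "weighted_norm (laplace_density \<sigma>) f \<noteq> 0"
  shows "(cmod (f x))\<^sup>2 * laplace_density \<sigma> x / (weighted_norm (laplace_density \<sigma>) f)\<^sup>2 \<le> laplace_bound s \<sigma> x"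
proof -
  obtain a \<omega> where f_eq: "f = (\<lambda>x. \<Sum>j=1..s. a j * exp (\<i> * complex_of_real (\<omega> j * x)))"
    using f by (auto simp: fourier_sparse_def)
  define k where "k = (if x \<ge> 0 then \<sigma> / sqrt 2 else - \<sigma> / sqrt 2)"
  define t where "t = sqrt 2 / \<sigma> * \<bar>x\<bar>"
  have k0: "k \<noteq> 0" and kabs: "\<bar>k\<bar> = \<sigma> / sqrt 2" using \<open>\<sigma> > 0\<close> by (auto simp: k_def)
  have t: "t \<ge> 0" and x: "x = k * t" using \<open>\<sigma> > 0\<close> by (auto simp: k_def t_def)
  define g where "g = exp_sum {1..s} a (\<lambda>j. \<i> * of_real (\<omega> j * k))"
  have fg: "f (k * u) = g u" for u
    by (simp add: f_eq g_def exp_sum_def mult_ac)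
  define E where "E = (\<integral>u. (cmod (g u))\<^sup>2 * exp (- \<bar>u\<bar>) \<partial>lborel)"
  have dens: "laplace_density \<sigma> (k * u) = 1 / (sqrt 2 * \<sigma>) * exp (- \<bar>u\<bar>)" for u
    using \<open>\<sigma> > 0\<close> by (simp add: laplace_density_def abs_mult kabs)
  have "(\<integral>y. (cmod (f y))\<^sup>2 * laplace_density \<sigma> y \<partial>lborel)
      = \<bar>k\<bar> * (\<integral>u. (cmod (f (0 + k * u)))\<^sup>2 * laplace_density \<sigma> (0 + k * u) \<partial>lborel)"
    using lborel_integral_real_affine[OF k0, of "\<lambda>y. (cmod (f y))\<^sup>2 * laplace_density \<sigma> y" 0] by simp
  also have "\<dots> = \<bar>k\<bar> * (\<integral>u. 1 / (sqrt 2 * \<sigma>) * ((cmod (g u))\<^sup>2 * exp (- \<bar>u\<bar>)) \<partial>lborel)"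
    unfolding add_0 fg dens by (simp add: mult_ac)
  \<comment> \<open>The Jacobian \<open>\<sigma> / sqrt 2\<close> times the density constant
    \<open>1 / (sqrt 2 * \<sigma>)\<close> is \<open>1/2\<close>.\<close>
  also have "\<dots> = E / 2"
    unfolding integral_mult_right_zero E_def using \<open>\<sigma> > 0\<close> by (simp add: kabs)
  finally have N: "(\<integral>y. (cmod (f y))\<^sup>2 * laplace_density \<sigma> y \<partial>lborel) = E / 2" .
  have "E \<ge> 0" unfolding E_def by (intro integral_nonneg_AE AE_I2) simp
  then have N2: "(weighted_norm (laplace_density \<sigma>) f)\<^sup>2 = E / 2"
    by (simp add: weighted_norm_def N)
  then have "E > 0" using \<open>E \<ge> 0\<close> assms(4) by (metis div_0 less_eq_real_def zero_eq_power2)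
  have "(cmod (g t))\<^sup>2 * exp (- t) \<le> rescaled_bound s t * E"
    using exp_sum_laplace_pointwise[of "{1..s}" t a "\<lambda>j. \<omega> j * k"] t assms(1) by (simp add: g_def E_def)
  then have le: "(cmod (g t))\<^sup>2 * exp (- t) / E \<le> rescaled_bound s t"
    using \<open>E > 0\<close> by (simp add: field_simps)
  have "(cmod (f x))\<^sup>2 * laplace_density \<sigma> x / (weighted_norm (laplace_density \<sigma>) f)\<^sup>2
      = 2 / (sqrt 2 * \<sigma>) * ((cmod (g t))\<^sup>2 * exp (- t) / E)"
    unfolding N2 x fg dens using t by simp
  also have "2 / (sqrt 2 * \<sigma>) = sqrt 2 / \<sigma>"
    using \<open>\<sigma> > 0\<close> by (simp add: field_simps)
  also have "sqrt 2 / \<sigma> * ((cmod (g t))\<^sup>2 * exp (- t) / E) \<le> sqrt 2 / \<sigma> * rescaled_bound s t"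
    using le \<open>\<sigma> > 0\<close> by (intro mult_left_mono) auto
  also have "rescaled_bound s t = rescaled_bound s (sqrt 2 / \<sigma> * x)"
    using \<open>\<sigma> > 0\<close> by (simp add: rescaled_bound_def t_def abs_mult)
  finally show ?thesis by (simp add: laplace_bound_eq_rescaled_bound[OF \<open>\<sigma> > 0\<close>])
qed

lemma laplace_bound_integral:
  assumes "\<sigma> > 0"
  shows "integrable lborel (laplace_bound s \<sigma>)"
    and "integral\<^sup>L lborel (laplace_bound s \<sigma>) = integral\<^sup>L lborel (rescaled_bound s)"
proof -
  have k: "sqrt 2 / \<sigma> \<noteq> 0" using assms by simp
  have eq: "laplace_bound s \<sigma> = (\<lambda>x. sqrt 2 / \<sigma> * rescaled_bound s (0 + sqrt 2 / \<sigma> * x))"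
    using laplace_bound_eq_rescaled_bound[OF assms] by auto
  show "integrable lborel (laplace_bound s \<sigma>)"
    unfolding eq lborel_integrable_real_affine_iff[OF k]
    by (intro integrable_mult_right) (simp only: lborel_integrable_real_affine_iff[OF k] rescaled_bound_integral)
  show "integral\<^sup>L lborel (laplace_bound s \<sigma>) = integral\<^sup>L lborel (rescaled_bound s)"
    using assms unfolding eq integral_mult_right_zero
    by (subst lborel_integral_real_affine[OF k, of "rescaled_bound s" 0]) simp
qed

theorem theorem2:
  "(\<forall>(s::nat) (\<sigma>::real). s \<ge> 1 \<longrightarrow> \<sigma> > 0 \<longrightarrow>
      (\<forall>x::real. leverage_score s (laplace_density \<sigma>) x \<le> ereal (laplace_bound s \<sigma> x)) \<and>
      integrable lborel (laplace_bound s \<sigma>)) \<and>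
   (\<lambda>(s::nat, \<sigma>::real). \<integral>x. laplace_bound s \<sigma> x \<partial>lborel)
      \<in> O[at_top \<times>\<^sub>F principal {\<sigma>. \<sigma> > 0}](\<lambda>(s, \<sigma>). real s * ln (real s))"
proof (intro conjI allI impI)
  fix s :: nat and \<sigma> x :: real
  assume "s \<ge> 1" "\<sigma> > 0"
  then show "leverage_score s (laplace_density \<sigma>) x \<le> ereal (laplace_bound s \<sigma> x)"
    unfolding leverage_score_def by (intro SUP_least) (auto intro: fourier_sparse_laplace_ratio)
next
  fix s :: nat and \<sigma> :: real
  assume "\<sigma> > 0"
  then show "integrable lborel (laplace_bound s \<sigma>)" by (rule laplace_bound_integral)
next
  \<comment> \<open>19 is the least \<open>s\<close> with \<open>1 + 18 * s \<le> s * s\<close>,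
    which gives the bound \<open>2 * ln (real s)\<close> on the logarithm. It also ensures
    \<open>ln (real s) \<ge> 1\<close>, so the constant 6 is absorbed.\<close>
  have bound: "norm (integral\<^sup>L lborel (laplace_bound s \<sigma>)) \<le> (4 * exp 2 + 12) * norm (real s * ln (real s))"
    if s: "s \<ge> 19" and "\<sigma> > 0" for s \<sigma>
  proof -
    have "1 + 18 * real s \<le> real s * real s"
    proof -
      have "19 * real s \<le> real s * real s" using s by (intro mult_right_mono) auto
      then show ?thesis using s by linarith
    qed
    then have "ln (1 + 18 * real s) \<le> ln (real s * real s)"
      using s by (subst ln_le_cancel_iff) auto
    then have *: "ln (1 + 18 * real s) \<le> 2 * ln (real s)"
      using s by (simp add: ln_mult)
    have "exp 1 \<le> real s" using exp_le s by linarith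
    then have "1 \<le> ln (real s)" using s by (subst ln_ge_iff) auto
    then have sl: "1 * 1 \<le> real s * ln (real s)" using s by (intro mult_mono) auto
    have "integral\<^sup>L lborel (rescaled_bound s) \<le> 2 * (exp 2 * real s * (2 * ln (real s)) + 6 * (real s * ln (real s)))"
      using * sl by (intro order.trans[OF rescaled_bound_integral(2)] mult_left_mono add_mono) auto
    also have "\<dots> = (4 * exp 2 + 12) * (real s * ln (real s))"
      by (simp add: algebra_simps)
    finally show ?thesis
      using rescaled_bound_integral(3)[of s] sl laplace_bound_integral(2)[OF \<open>\<sigma> > 0\<close>, of s] by simp
  qed
  \<comment> \<open>The constant is uniform in \<sigma>, so only \<open>s\<close> has to be
    large.\<close>
  have "\<forall>\<^sub>F p in at_top \<times>\<^sub>F principal {\<sigma>::real. \<sigma> > 0}. fst p \<ge> (19::nat) \<and> snd p > 0"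
    unfolding eventually_prod_filter
    by (rule exI[of _ "\<lambda>s. s \<ge> 19"], rule exI[of _ "\<lambda>\<sigma>. \<sigma> > 0"])
       (auto simp: eventually_principal eventually_ge_at_top)
  then show "(\<lambda>(s::nat, \<sigma>::real). \<integral>x. laplace_bound s \<sigma> x \<partial>lborel)
      \<in> O[at_top \<times>\<^sub>F principal {\<sigma>. \<sigma> > 0}](\<lambda>(s, \<sigma>). real s * ln (real s))"
    by (intro bigoI[of _ "4 * exp 2 + 12"], elim eventually_mono) (use bound in auto)
qed

end
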